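(* Let $d\ge 1$ be an integer. The Funk distance $\rho_{\mathrm{FD}}$ and the Hilbert distance $\rho_{\mathrm{HG}}$ on the open standard simplex satisfy information monotonicity: for every $m\le d$, every partition $\mathcal{X}=\{X_1,\ldots,X_m\}$ of $\{1,\ldots,d\}$ into $m$ pairwise disjoint nonempty subsets, and all $p,q\in\Delta_d$, $$\rho_{\mathrm{FD}}(p_{|\mathcal{X}},q_{|\mathcal{X}})\le \rho_{\mathrm{FD}}(p,q)\quad\text{and}\quad \rho_{\mathrm{HG}}(p_{|\mathcal{X}},q_{|\mathcal{X}})\le \rho_{\mathrm{HG}}(p,q).$$
   Context: For an integer $d\ge 1$, $\Delta_d=\{(x_1,\ldots,x_d)\in(0,\infty)^d : \sum_{i=1}^d x_i=1\}$ is the open standard simplex. For $p,q\in\Delta_d$ the Funk distance is $\rho_{\mathrm{FD}}(p,q)=\log\max_{1\le i\le d}\frac{p_i}{q_i}$, and the Hilbert distance is $\rho_{\mathrm{HG}}(p,q)=\rho_{\mathrm{FD}}(p,q)+\rho_{\mathrm{FD}}(q,p)=\log\frac{\max_{1\le i\le d} p_i/q_i}{\min_{1\le i\le d} p_i/q_i}$; the same formulas are used on $\Delta_m$ for every $m$. For a partition $\mathcal{X}=\{X_1,\ldots,X_m\}$ of $\{1,\ldots,d\}$ and $p\in\Delta_d$, the coarse-grained point $p_{|\mathcal{X}}\in\Delta_m$ has $i$-th coordinate $\sum_{j\in X_i}p_j$, for $i=1,\ldots,m$. *)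

theory Defs
  imports Complex_Main "HOL-Library.FuncSet" "HOL-Library.Disjoint_Sets"
begin

(* A d-tuple is a function on nat that is extensional on {1..d}, i.e. undefined outside,
   so that equality of tuples is equality of functions. *)
definition open_simplex :: "nat \<Rightarrow> (nat \<Rightarrow> real) set" where
  "open_simplex d = {x \<in> {1..d} \<rightarrow>\<^sub>E {0<..}. (\<Sum>i=1..d. x i) = 1}"

(* Max is only meaningful for d > 0; open_simplex 0 is empty, so d = 0 never matters. *)
definition funk_dist :: "nat \<Rightarrow> (nat \<Rightarrow> real) \<Rightarrow> (nat \<Rightarrow> real) \<Rightarrow> real" where
  "funk_dist d p q = ln (MAX i\<in>{1..d}. p i / q i)"

definition hilbert_dist :: "nat \<Rightarrow> (nat \<Rightarrow> real) \<Rightarrow> (nat \<Rightarrow> real) \<Rightarrow> real" where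
  "hilbert_dist d p q = funk_dist d p q + funk_dist d q p"

definition coarse_grain :: "nat \<Rightarrow> (nat \<Rightarrow> nat set) \<Rightarrow> (nat \<Rightarrow> real) \<Rightarrow> (nat \<Rightarrow> real)" where
  "coarse_grain m X p = (\<lambda>i\<in>{1..m}. \<Sum>j\<in>X i. p j)"

lemma open_simplex_pos:
  assumes "x \<in> open_simplex d" and "i \<in> {1..d}"
  shows "x i > 0"
proof -
  have "x \<in> {1..d} \<rightarrow>\<^sub>E {0<..}"
    using assms(1) by (simp only: open_simplex_def mem_Collect_eq)
  from PiE_mem[OF this assms(2)] show ?thesis
    by (simp only: greaterThan_iff)
qed

lemma hilbert_dist_eq_ln_Max_div_Min:
  assumes p: "p \<in> open_simplex d" and q: "q \<in> open_simplex d"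
  shows "hilbert_dist d p q =
    ln ((MAX i\<in>{1..d}. p i / q i) / (MIN i\<in>{1..d}. p i / q i))"
proof -
  let ?I = "{1..d}"
  have ne: "?I \<noteq> {}"
    using p by (auto simp: open_simplex_def)
  have pos: "p i > 0" "q i > 0" if "i \<in> ?I" for i
    using open_simplex_pos[OF p that] open_simplex_pos[OF q that] by simp_all
  have M: "(MAX i\<in>?I. p i / q i) > 0"
    using ne pos by (subst Max_gr_iff) auto
  have m: "(MIN i\<in>?I. p i / q i) > 0"
    using ne pos by (subst Min_gr_iff) auto
  have "(MIN i\<in>?I. p i / q i) \<in> (\<lambda>i. p i / q i) ` ?I"
    using ne by (intro Min_in) auto
  then obtain k where k: "k \<in> ?I" "(MIN i\<in>?I. p i / q i) = p k / q k"
    by auto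
  have "(MAX i\<in>?I. q i / p i) = inverse (p k / q k)"
  proof (rule Max_eqI)
    fix y assume "y \<in> (\<lambda>i. q i / p i) ` ?I"
    then obtain i where i: "i \<in> ?I" "y = q i / p i" by auto
    have "p k / q k \<le> p i / q i"
      using i(1) by (subst k(2)[symmetric]) (intro Min_le, auto)
    then have "inverse (p i / q i) \<le> inverse (p k / q k)"
      using pos[OF k(1)] by (intro le_imp_inverse_le) auto
    then show "y \<le> inverse (p k / q k)"
      using i(2) by simp
  qed (use k(1) in auto)
  then have "funk_dist d q p = - ln (MIN i\<in>?I. p i / q i)"
    using m k(2) by (simp only: funk_dist_def ln_inverse)
  then show ?thesis
    using M m by (simp add: hilbert_dist_def funk_dist_def ln_div)
qed

lemma coarse_grain_in_open_simplex:
  assumes part: "partition_on {1..d} (X ` {1..m})" and inj: "inj_on X {1..m}"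
    and p: "p \<in> open_simplex d"
  shows "coarse_grain m X p \<in> open_simplex m"
proof -
  have sub: "X i \<subseteq> {1..d}" "X i \<noteq> {}" if "i \<in> {1..m}" for i
    using that partition_onD1[OF part] partition_onD3[OF part] by blast+
  have fin: "finite (X i)" if "i \<in> {1..m}" for i
    using sub(1)[OF that] by (rule finite_subset) simp
  have pos: "p j > 0" if "j \<in> {1..d}" for j
    using that by (rule open_simplex_pos[OF p])
  have disj: "X i \<inter> X j = {}" if "i \<in> {1..m}" "j \<in> {1..m}" "i \<noteq> j" for i j
  proof -
    have "X i \<noteq> X j"
      using inj that by (simp add: inj_on_eq_iff)
    moreover have "disjoint (X ` {1..m})"
      using part by (simp add: partition_on_def)
    ultimately show ?thesis
      using that by (blast dest: disjointD)
  qed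
  have "(\<Sum>i=1..m. \<Sum>j\<in>X i. p j) = (\<Sum>j\<in>(\<Union>i\<in>{1..m}. X i). p j)"
    by (rule sum.UNION_disjoint[symmetric]) (simp, use fin disj in blast, use disj in blast)
  also have "(\<Union>i\<in>{1..m}. X i) = {1..d}"
    using part by (simp add: partition_on_def)
  also have "(\<Sum>j=1..d. p j) = 1"
    using p by (simp add: open_simplex_def)
  finally have "(\<Sum>i=1..m. \<Sum>j\<in>X i. p j) = 1" .
  moreover have "(\<Sum>j\<in>X i. p j) > 0" if "i \<in> {1..m}" for i
    using that sub pos by (intro sum_pos fin) blast+
  ultimately show ?thesis
    by (auto simp: open_simplex_def coarse_grain_def)
qed

end

theory Submission
  imports Defs
begin

(* With M = max_j p_j / q_j we have p_j \<le> M * q_j for every j.  Summing over a block X_i gives the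
   same bound, with the same M, for the coarse-grained coordinates.  The Hilbert distance is the
   sum of the Funk distances in the two directions. *)

lemma funk_dist_coarse_grain_le:
  assumes part: "partition_on {1..d} (X ` {1..m})" and inj: "inj_on X {1..m}"
    and p: "p \<in> open_simplex d" and q: "q \<in> open_simplex d"
  shows "funk_dist m (coarse_grain m X p) (coarse_grain m X q) \<le> funk_dist d p q"
proof -
  let ?P = "coarse_grain m X p" and ?Q = "coarse_grain m X q"
  define M where "M = (MAX j\<in>{1..d}. p j / q j)"
  \<comment> \<open>Membership supplies positive coordinates, so that dividing by
    \<open>?Q i\<close> preserves the inequality.\<close>
  have P: "?P \<in> open_simplex m" and Q: "?Q \<in> open_simplex m"
    by (rule coarse_grain_in_open_simplex[OF part inj p], rule coarse_grain_in_open_simplex[OF part inj q])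
  \<comment> \<open>The empty sum is not 1, so \<open>open_simplex 0\<close> is empty and
    \<open>P\<close> excludes \<open>m = 0\<close>; the maximum below is then over a nonempty
    set.\<close>
  have ne: "{1..m} \<noteq> {}"
    using P by (auto simp: open_simplex_def)
  have pM: "p j \<le> M * q j" if "j \<in> {1..d}" for j
  proof -
    have "p j / q j \<le> M"
      unfolding M_def using that by (intro Max_ge) auto
    then show ?thesis
      using open_simplex_pos[OF q that] by (simp add: pos_divide_le_eq)
  qed
  have PM: "?P i / ?Q i \<le> M" if i: "i \<in> {1..m}" for i
  proof -
    have sub: "X i \<subseteq> {1..d}"
      using i partition_onD1[OF part] by blast
    have "(\<Sum>j\<in>X i. p j) \<le> M * (\<Sum>j\<in>X i. q j)"
      unfolding sum_distrib_left using sub pM by (intro sum_mono) blast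
    then have "?P i \<le> M * ?Q i"
      using i by (simp add: coarse_grain_def)
    then show ?thesis
      using open_simplex_pos[OF Q i] by (simp add: pos_divide_le_eq)
  qed
  have "(MAX i\<in>{1..m}. ?P i / ?Q i) \<le> M"
    using ne PM by (intro Max.boundedI) auto
  \<comment> \<open>\<open>ln_mono\<close> asks for a positive smaller argument.\<close>
  moreover have "(MAX i\<in>{1..m}. ?P i / ?Q i) > 0"
    using ne open_simplex_pos[OF P] open_simplex_pos[OF Q] by (subst Max_gr_iff) auto
  ultimately show ?thesis
    by (simp only: funk_dist_def M_def[symmetric] ln_mono)
qed

theorem theorem1:
  fixes d m :: nat and X :: "nat \<Rightarrow> nat set" and p q :: "nat \<Rightarrow> real"
  assumes "d \<ge> 1" and "m \<le> d"
    and "partition_on {1..d} (X ` {1..m})" and "inj_on X {1..m}"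
    and "p \<in> open_simplex d" and "q \<in> open_simplex d"
  shows "funk_dist m (coarse_grain m X p) (coarse_grain m X q) \<le> funk_dist d p q \<and>
    hilbert_dist m (coarse_grain m X p) (coarse_grain m X q) \<le> hilbert_dist d p q"
  \<comment> \<open>The Funk bound is used for \<open>p\<close>, \<open>q\<close> and again with the
    two exchanged, and the two inequalities are added.\<close>
  unfolding hilbert_dist_def
  using assms(3-) by (intro conjI add_mono funk_dist_coarse_grain_le)

end
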